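(* Let $0\le\alpha<1$, let $\beta_1,\beta_2,\delta_1,\delta_2\ge 0$ and $\alpha_1,\alpha_2,\gamma_1,\gamma_2>0$ be real, and let $|\sigma|<1$. Let $f=h+\overline{g}\in\hat H$ with $h(z)=z+\sum_{n\ge2}A_nz^n$, $g(z)=\sum_{n\ge1}B_nz^n$. Write $W_i=W_{(\alpha_i,\beta_i),(\gamma_i,\delta_i)}$ for $i=1,2$. If $|A_n|\le 1$ for all $n\ge 2$, $|B_n|\le 1$ for all $n\ge 1$, and $$\big(W_1'(1)-1\big)-\alpha\big(W_1(1)-1\big)+|\sigma|\big(W_2'(1)+\alpha W_2(1)\big)\le 1-\alpha,$$ then $L(f)\in HS^*(\alpha)$.
   Context: $D=\{z\in\mathbb C:|z|<1\}$. $\hat H$ is the class of complex-valued harmonic functions $f=h+\overline g$ on $D$ with $h,g$ analytic in $D$, $h(z)=z+\sum_{n=2}^\infty A_nz^n$, $g(z)=\sum_{n=1}^\infty B_nz^n$, $|B_1|<1$. For $0\le\alpha<1$, $HS^*(\alpha)$ (harmonic starlike functions of order $\alpha$) is the class of $f\in\hat H$ with $\frac{\partial}{\partial\theta}\arg f(re^{i\theta})>\alpha$ for all $0<r<1$, $0\le\theta\le2\pi$. Normalized four-parameter Wright function: for real $a,c>0$ and $b,d\ge0$, $$W_{(a,b),(c,d)}(z)=z+\sum_{n=2}^\infty\frac{\Gamma(a)\Gamma(c)}{\Gamma(a+(n-1)b)\,\Gamma(c+(n-1)d)}z^n .$$ $W(1),W'(1)$ denote the sums at $z=1$ of this series and of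 its termwise derivative; a hypothesis involving them is understood to include that they are finite (automatic if $b+d>0$). The operator $L$ (depending on $\alpha_i,\beta_i,\gamma_i,\delta_i$, $i=1,2$, and $\sigma$) is $L(f)=H+\overline{\sigma G}$, where $H=h*W_{(\alpha_1,\beta_1),(\gamma_1,\delta_1)}$ and $G=g*W_{(\alpha_2,\beta_2),(\gamma_2,\delta_2)}$ are Hadamard products, i.e. $$H(z)=z+\sum_{n=2}^\infty\frac{\Gamma(\alpha_1)\Gamma(\gamma_1)A_n z^n}{\Gamma(\alpha_1+(n-1)\beta_1)\Gamma(\gamma_1+(n-1)\delta_1)},\quad G(z)=\sum_{n=1}^\infty\frac{\Gamma(\alpha_2)\Gamma(\gamma_2)B_n z^n}{\Gamma(\alpha_2+(n-1)\beta_2)\Gamma(\gamma_2+(n-1)\delta_2)}.$$ *)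

theory Defs
  imports "HOL-Complex_Analysis.Complex_Analysis"
begin

text \<open>
  Functions on the unit disk are total functions on \<^typ>\<open>complex\<close> whose values outside
  \<^term>\<open>ball (0::complex) 1\<close> are irrelevant. A sum of an analytic function and the conjugate of an
  analytic function is automatically harmonic, so harmonicity is not a separate clause below.
\<close>

definition harmonic_rep ::
  "(complex \<Rightarrow> complex) \<Rightarrow> (complex \<Rightarrow> complex) \<Rightarrow> (complex \<Rightarrow> complex) \<Rightarrow>
    (nat \<Rightarrow> complex) \<Rightarrow> (nat \<Rightarrow> complex) \<Rightarrow> bool"
  where
  "harmonic_rep f h g A B \<longleftrightarrow>
     h holomorphic_on ball 0 1 \<and> g holomorphic_on ball 0 1 \<and>
     (\<forall>z\<in>ball 0 1. f z = h z + cnj (g z)) \<and>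
     (\<forall>z\<in>ball 0 1. (\<lambda>n. A (n + 2) * z ^ (n + 2)) sums (h z - z)) \<and>
     (\<forall>z\<in>ball 0 1. (\<lambda>n. B (n + 1) * z ^ (n + 1)) sums g z) \<and>
     cmod (B 1) < 1"

definition H_hat :: "(complex \<Rightarrow> complex) set"
  where "H_hat = {f. \<exists>h g A B. harmonic_rep f h g A B}"

text \<open>
  The argument of a nonvanishing curve \<open>u\<close> is differentiated through a local branch \<open>\<phi>\<close>; the value
  \<open>d\<close> does not depend on the branch, since two branches that are continuous at \<open>t\<close> differ by a
  constant near \<open>t\<close>.
\<close>

definition has_arg_derivative :: "(real \<Rightarrow> complex) \<Rightarrow> real \<Rightarrow> real \<Rightarrow> bool"
  where
  "has_arg_derivative u d t \<longleftrightarrow>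
     (\<exists>\<phi>. (\<phi> has_real_derivative d) (at t) \<and>
          (\<forall>\<^sub>F s in nhds t. u s \<noteq> 0 \<and> is_Arg (u s) (\<phi> s)))"

definition HS_star :: "real \<Rightarrow> (complex \<Rightarrow> complex) set"
  where
  "HS_star \<alpha> =
     {f \<in> H_hat. \<forall>r \<theta>. 0 < r \<and> r < 1 \<and> 0 \<le> \<theta> \<and> \<theta> \<le> 2 * pi \<longrightarrow>
        (\<exists>d. has_arg_derivative (\<lambda>t. f (rcis r t)) d \<theta> \<and> d > \<alpha>)}"

definition wright_coeff :: "real \<Rightarrow> real \<Rightarrow> real \<Rightarrow> real \<Rightarrow> nat \<Rightarrow> real"
  where
  "wright_coeff a b c d n =
     Gamma a * Gamma c / (Gamma (a + (real n - 1) * b) * Gamma (c + (real n - 1) * d))"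

definition wright ::
  "real \<Rightarrow> real \<Rightarrow> real \<Rightarrow> real \<Rightarrow> 'a::{real_normed_field,banach} \<Rightarrow> 'a"
  where "wright a b c d z = z + (\<Sum>n. of_real (wright_coeff a b c d (n + 2)) * z ^ (n + 2))"

text \<open>The termwise derivative of the series.\<close>

definition wright_deriv ::
  "real \<Rightarrow> real \<Rightarrow> real \<Rightarrow> real \<Rightarrow> 'a::{real_normed_field,banach} \<Rightarrow> 'a"
  where
  "wright_deriv a b c d z =
     1 + (\<Sum>n. of_nat (n + 2) * of_real (wright_coeff a b c d (n + 2)) * z ^ (n + 1))"

text \<open>
  Convergence at \<open>1\<close> of both series; without it \<^const>\<open>suminf\<close> would return an arbitrary value.
\<close>

definition wright_finite_at_1 :: "real \<Rightarrow> real \<Rightarrow> real \<Rightarrow> real \<Rightarrow> bool"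
  where
  "wright_finite_at_1 a b c d \<longleftrightarrow>
     summable (\<lambda>n. wright_coeff a b c d (n + 2)) \<and>
     summable (\<lambda>n. real (n + 2) * wright_coeff a b c d (n + 2))"

definition hadamard_product ::
  "(complex \<Rightarrow> complex) \<Rightarrow> (complex \<Rightarrow> complex) \<Rightarrow> complex \<Rightarrow> complex"
  where
  "hadamard_product p q z =
     (\<Sum>n. ((deriv ^^ n) p 0 / fact n) * ((deriv ^^ n) q 0 / fact n) * z ^ n)"

text \<open>
  The analytic and co-analytic parts of a member of \<^term>\<open>H_hat\<close> are unique on the disk
  (\<open>harmonic_rep_unique\<close> below), so the choices are harmless.
\<close>

definition analytic_part :: "(complex \<Rightarrow> complex) \<Rightarrow> complex \<Rightarrow> complex"
  where "analytic_part f = (SOME h. \<exists>g A B. harmonic_rep f h g A B)"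

definition coanalytic_part :: "(complex \<Rightarrow> complex) \<Rightarrow> complex \<Rightarrow> complex"
  where "coanalytic_part f = (SOME g. \<exists>h A B. harmonic_rep f h g A B)"

definition wright_op ::
  "real \<Rightarrow> real \<Rightarrow> real \<Rightarrow> real \<Rightarrow> real \<Rightarrow> real \<Rightarrow> real \<Rightarrow> real \<Rightarrow> complex \<Rightarrow>
    (complex \<Rightarrow> complex) \<Rightarrow> complex \<Rightarrow> complex"
  where
  "wright_op \<alpha>\<^sub>1 \<beta>\<^sub>1 \<gamma>\<^sub>1 \<delta>\<^sub>1 \<alpha>\<^sub>2 \<beta>\<^sub>2 \<gamma>\<^sub>2 \<delta>\<^sub>2 \<sigma> f = (\<lambda>z.
     hadamard_product (analytic_part f) (wright \<alpha>\<^sub>1 \<beta>\<^sub>1 \<gamma>\<^sub>1 \<delta>\<^sub>1) z +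
     cnj (\<sigma> * hadamard_product (coanalytic_part f) (wright \<alpha>\<^sub>2 \<beta>\<^sub>2 \<gamma>\<^sub>2 \<delta>\<^sub>2) z))"

lemma harmonic_rep_0:
  assumes "harmonic_rep f h g A B"
  shows "h 0 = 0" "g 0 = 0"
proof -
  have "(\<lambda>n. A (n + 2) * 0 ^ (n + 2)) sums (h 0 - 0)" "(\<lambda>n. B (n + 1) * 0 ^ (n + 1)) sums g 0"
    using assms unfolding harmonic_rep_def by (metis centre_in_ball zero_less_one)+
  then show "h 0 = 0" "g 0 = 0"
    by (auto dest: sums_unique)
qed

lemma holomorphic_Re_zero_imp_constant:
  assumes "p holomorphic_on ball 0 1" and re: "\<And>w. w \<in> ball 0 1 \<Longrightarrow> Re (p w) = 0"
  shows "p constant_on ball 0 1"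
proof (rule ccontr)
  assume "\<not> p constant_on ball 0 1"
  then have "open (p ` ball 0 1)"
    by (intro open_mapping_thm[OF assms(1)]) auto
  moreover have "p 0 \<in> p ` ball 0 1"
    by simp
  ultimately obtain e where e: "e > 0" "cball (p 0) e \<subseteq> p ` ball 0 1"
    by (meson open_contains_cball)
  have "p 0 + of_real e \<in> cball (p 0) e"
    using e(1) by (simp add: dist_norm)
  then obtain w where "w \<in> ball 0 1" "p w = p 0 + of_real e"
    using e(2) by force
  then have "Re (p 0 + of_real e) = 0"
    using re by metis
  then show False
    using re[of 0] e(1) by simp
qed

lemma harmonic_rep_unique:
  assumes 1: "harmonic_rep f h g A B" and 2: "harmonic_rep f h' g' A' B'"
    and z: "z \<in> ball 0 1"
  shows "h z = h' z" "g z = g' z"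
proof -
  have eq: "h w - h' w = cnj (g' w - g w)" if "w \<in> ball 0 1" for w
    using 1 2 that unfolding harmonic_rep_def by (auto simp: algebra_simps)
  have hol: "(\<lambda>w. h w - h' w) holomorphic_on ball 0 1" "(\<lambda>w. g' w - g w) holomorphic_on ball 0 1"
    using 1 2 unfolding harmonic_rep_def by (auto intro!: holomorphic_intros)
  have "(\<lambda>w. \<i> * ((h w - h' w) + (g' w - g w))) constant_on ball 0 1"
  proof (rule holomorphic_Re_zero_imp_constant)
    show "Re (\<i> * ((h w - h' w) + (g' w - g w))) = 0" if "w \<in> ball 0 1" for w
      using eq[OF that] by (simp add: complex_eq_iff)
    show "(\<lambda>w. \<i> * ((h w - h' w) + (g' w - g w))) holomorphic_on ball 0 1"
      by (rule holomorphic_on_mult[OF holomorphic_on_const holomorphic_on_add[OF hol]])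
  qed
  then obtain c where c: "\<And>w. w \<in> ball 0 1 \<Longrightarrow> \<i> * ((h w - h' w) + (g' w - g w)) = c"
    unfolding constant_on_def by blast
  have "(\<lambda>w. (h w - h' w) - (g' w - g w)) constant_on ball 0 1"
  proof (rule holomorphic_Re_zero_imp_constant)
    show "Re ((h w - h' w) - (g' w - g w)) = 0" if "w \<in> ball 0 1" for w
      using eq[OF that] by (simp add: complex_eq_iff)
    show "(\<lambda>w. (h w - h' w) - (g' w - g w)) holomorphic_on ball 0 1"
      by (rule holomorphic_on_diff[OF hol])
  qed
  then obtain k where k: "\<And>w. w \<in> ball 0 1 \<Longrightarrow> (h w - h' w) - (g' w - g w) = k"
    unfolding constant_on_def by blast
  have "c = 0" "k = 0"
    using c[of 0] k[of 0] harmonic_rep_0[OF 1] harmonic_rep_0[OF 2] by auto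
  then have "(h z - h' z) + (g' z - g z) = 0" "(h z - h' z) - (g' z - g z) = 0"
    using c[OF z] k[OF z] by auto
  then show "h z = h' z" "g z = g' z"
    by (auto simp: complex_eq_iff)
qed

end

theory Submission
  imports Defs
begin

text \<open>
  For \<open>F = H + cnj G\<close> and \<open>N = z H' - cnj (z G')\<close>, the derivative of \<open>arg F\<close> along a circle is
  \<open>Re (N / F)\<close>, which exceeds \<open>\<alpha>\<close> as soon as \<open>|N - (1 + \<alpha>) F| < |N + (1 - \<alpha>) F|\<close>. Comparing the
  two sides term by term, this follows from the coefficient condition
  \<open>\<Sum>n\<ge>2. (n - \<alpha>) |a n| + \<Sum>n\<ge>1. (n + \<alpha>) |b n| \<le> 1 - \<alpha>\<close>. The inequality is strict because
  \<open>|z|\<^sup>2 < |z|\<close> gains on the terms with \<open>n \<ge> 2\<close>, and the term \<open>n = 1\<close> alone stays below \<open>1 - \<alpha>\<close>. The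
  coefficients of \<open>L(f)\<close> are dominated by the positive Wright coefficients, so the hypothesis at \<open>1\<close>
  gives the coefficient condition.
\<close>

section \<open>The derivative of the argument along a curve\<close>

text \<open>\<open>Arg\<close> itself may jump at \<open>u t\<close>, so the branch is built from
  the quotient \<open>u s / u t\<close>. At \<open>s = t\<close> this equals 1, away from the cut of
  \<open>Ln\<close>, and the chain rule applies there.\<close>

lemma has_arg_derivative_Im:
  fixes u :: "real \<Rightarrow> complex"
  assumes der: "(u has_vector_derivative u') (at t)" and nz: "u t \<noteq> 0"
  shows "has_arg_derivative u (Im (u' / u t)) t"
proof -
  define \<phi> where "\<phi> = (\<lambda>s. Arg (u t) + Im (Ln (u s / u t)))"
  have 1: "((\<lambda>s. u s / u t) has_vector_derivative (u' / u t)) (at t)"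
    using has_vector_derivative_mult_left[OF der, of "inverse (u t)"] by (simp add: divide_inverse)
  have "(Ln has_field_derivative inverse (u t / u t)) (at (u t / u t))"
    using nz by (intro has_field_derivative_Ln) auto
  from field_vector_diff_chain_at[OF 1 this]
  have "((\<lambda>s. Ln (u s / u t)) has_vector_derivative (u' / u t)) (at t)"
    using nz by (simp add: o_def)
  then have "((\<lambda>s. Im (Ln (u s / u t))) has_vector_derivative Im (u' / u t)) (at t)"
    by (rule bounded_linear.has_vector_derivative[OF bounded_linear_Im])
  then have "(\<phi> has_real_derivative Im (u' / u t)) (at t)"
    unfolding \<phi>_def has_real_derivative_iff_has_vector_derivative
    by (auto intro!: derivative_eq_intros)
  moreover have "\<forall>\<^sub>F s in nhds t. u s \<noteq> 0 \<and> is_Arg (u s) (\<phi> s)"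
  proof -
    have "isCont u t"
      using der has_vector_derivative_continuous by blast
    then have "(u \<longlongrightarrow> u t) (nhds t)"
      by (simp add: isCont_def tendsto_at_iff_tendsto_nhds)
    then have "\<forall>\<^sub>F s in nhds t. u s \<noteq> 0"
      using nz by (rule tendsto_imp_eventually_ne)
    then show ?thesis
    proof eventually_elim
      case (elim s)
      define w where "w = u s / u t"
      have "w \<noteq> 0"
        using elim nz by (simp add: w_def)
      \<comment> \<open>The polar form holds for every nonzero \<open>w\<close>, also on the cut of
        \<open>Ln\<close>, so nonvanishing of \<open>u s\<close> is the only condition on the
        neighbourhood of \<open>t\<close>.\<close>
      then have "Ln w = of_real (ln (cmod w)) + \<i> * of_real (Im (Ln w))"
        by (simp add: complex_eq_iff)
      then have "exp (Ln w) = of_real (cmod w) * exp (\<i> * of_real (Im (Ln w)))"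
        using \<open>w \<noteq> 0\<close> by (metis exp_add exp_ln exp_of_real zero_less_norm_iff)
      then have w: "w = of_real (cmod w) * exp (\<i> * of_real (Im (Ln w)))"
        using \<open>w \<noteq> 0\<close> by simp
      have ut: "u t = of_real (cmod (u t)) * exp (\<i> * of_real (Arg (u t)))"
        using is_Arg_Arg[OF nz] unfolding is_Arg_def .
      have "u s = u t * w"
        using nz by (simp add: w_def)
      also have "\<dots> = (of_real (cmod (u t)) * exp (\<i> * of_real (Arg (u t)))) *
          (of_real (cmod w) * exp (\<i> * of_real (Im (Ln w))))"
        using ut w by (rule arg_cong2)
      also have "\<dots> = of_real (cmod (u t) * cmod w) * exp (\<i> * of_real (\<phi> s))"
        by (simp add: \<phi>_def w_def[symmetric] distrib_left exp_add mult_ac)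
      finally have "u s = of_real (cmod (u t) * cmod w) * exp (\<i> * of_real (\<phi> s))" .
      moreover have "cmod (u t) * cmod w = cmod (u s)"
        using nz by (simp add: w_def norm_divide)
      ultimately show ?case
        using elim by (simp add: is_Arg_def)
    qed
  qed
  ultimately show ?thesis
    unfolding has_arg_derivative_def by blast
qed

section \<open>Power series on the unit disk\<close>

text \<open>\<open>hadamard_product\<close> reads its coefficients from iterated derivatives at 0.
  Convergence on the disk gives a positive radius of convergence, hence a formal power series
  expansion whose coefficients are these derivatives.\<close>

lemma power_series_taylor_coeff:
  fixes p :: "complex \<Rightarrow> complex"
  assumes sums: "\<And>z. z \<in> ball 0 1 \<Longrightarrow> (\<lambda>n. c n * z ^ n) sums p z"
  shows "(deriv ^^ n) p 0 / fact n = c n"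
proof -
  have rad: "fps_conv_radius (Abs_fps c) \<ge> 1"
    unfolding fps_conv_radius_def
  proof (rule conv_radius_geI_ex')
    fix r assume "0 < r" "ereal r < 1"
    then have "of_real r \<in> ball (0::complex) 1"
      by simp
    then show "summable (\<lambda>n. fps_nth (Abs_fps c) n * of_real r ^ n)"
      using sums by (simp add: sums_iff)
  qed
  have "\<forall>\<^sub>F z in nhds 0. z \<in> ball (0::complex) 1"
    by (rule eventually_nhds_in_open) auto
  then have "\<forall>\<^sub>F z in nhds 0. eval_fps (Abs_fps c) z = p z"
    by eventually_elim (use sums in \<open>auto simp: eval_fps_def sums_iff\<close>)
  moreover have "fps_conv_radius (Abs_fps c) > 0"
    using rad by (rule less_le_trans[rotated]) simp
  ultimately have "p has_fps_expansion Abs_fps c"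
    unfolding has_fps_expansion_def by blast
  then have "fps_nth (Abs_fps c) n = (deriv ^^ n) p 0 / fact n"
    by (rule fps_nth_fps_expansion)
  then show ?thesis
    by simp
qed

text \<open>All powers from the second on are at most \<open>(cmod z)\<^sup>2\<close>. This factor
  is the later source of strictness.\<close>

lemma power_series_tail_bound:
  fixes e :: "nat \<Rightarrow> complex"
  assumes S: "(\<lambda>n. e n * z ^ n) sums S" and sm: "summable (\<lambda>n. cmod (e n))" and z: "cmod z \<le> 1"
  shows "cmod (S - e 0 - e 1 * z) \<le> (cmod z)\<^sup>2 * (\<Sum>n. cmod (e (n + 2)))"
proof -
  have T: "(\<lambda>n. e (n + 2) * z ^ (n + 2)) sums (S - e 0 - e 1 * z)"
    using sums_split_initial_segment[OF S, of 2] by (simp add: numeral_2_eq_2 algebra_simps)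
  have sm2: "summable (\<lambda>n. (cmod z)\<^sup>2 * cmod (e (n + 2)))"
    by (intro summable_mult summable_ignore_initial_segment sm)
  have le: "cmod (e (n + 2) * z ^ (n + 2)) \<le> (cmod z)\<^sup>2 * cmod (e (n + 2))" for n
  proof -
    have "cmod z ^ (n + 2) \<le> (cmod z)\<^sup>2"
      using z by (intro power_decreasing) auto
    then show ?thesis
      by (simp add: norm_mult norm_power mult.commute mult_left_mono)
  qed
  have "cmod (\<Sum>n. e (n + 2) * z ^ (n + 2)) \<le> (\<Sum>n. (cmod z)\<^sup>2 * cmod (e (n + 2)))"
    using le by (rule norm_suminf_le[OF _ sm2])
  also have "\<dots> = (cmod z)\<^sup>2 * (\<Sum>n. cmod (e (n + 2)))"
    by (rule suminf_mult) (rule summable_ignore_initial_segment[OF sm])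
  finally show ?thesis
    using T by (simp add: sums_iff)
qed

text \<open>Multiplying the derivative by \<open>z\<close> restores the exponent \<open>n\<close>,
  so that \<open>z * D\<close> and \<open>p z\<close> can be combined term by term.\<close>

lemma power_series_derivative:
  fixes c :: "nat \<Rightarrow> complex"
  assumes sums: "\<And>z. z \<in> ball 0 1 \<Longrightarrow> (\<lambda>n. c n * z ^ n) sums p z" and z: "z \<in> ball 0 1"
  shows "\<exists>D. (p has_field_derivative D) (at z) \<and> (\<lambda>n. of_nat n * c n * z ^ n) sums (z * D)"
proof -
  define D where "D = (\<Sum>n. diffs c n * z ^ n)"
  have sm: "summable (\<lambda>n. c n * w ^ n)" if "norm w < 1" for w
    using sums[of w] that by (auto simp: sums_iff)
  have "((\<lambda>w. \<Sum>n. c n * w ^ n) has_field_derivative D) (at z)"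
    unfolding D_def by (rule termdiffs_strong'[of 1]) (use sm z in auto)
  then have "(p has_field_derivative D) (at z)"
    by (rule has_field_derivative_transform_within_open[of _ _ _ "ball 0 1"])
      (use sums z in \<open>auto simp: sums_iff\<close>)
  moreover have "summable (\<lambda>n. diffs c n * z ^ n)"
    by (rule termdiff_converges[of _ 1]) (use sm z in auto)
  then have "(\<lambda>n. of_nat n * c n * z ^ (n - Suc 0)) sums D"
    unfolding D_def by (rule diffs_equiv)
  from sums_mult[OF this, of z]
  have "(\<lambda>n. of_nat n * c n * z ^ n) sums (z * D)"
  proof (rule sums_cong[THEN iffD1, rotated])
    \<comment> \<open>Truncated subtraction at \<open>n = 0\<close> is harmless because the factor
      \<open>of_nat n\<close> vanishes there.\<close>
    show "z * (of_nat n * c n * z ^ (n - Suc 0)) = of_nat n * c n * z ^ n" for n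
      by (cases n) auto
  qed
  ultimately show ?thesis
    by blast
qed

section \<open>A coefficient criterion for harmonic starlikeness\<close>

text \<open>For \<open>w = N / F\<close> the assumption says that \<open>w\<close> is closer to
  \<open>1 + \<alpha>\<close> than to \<open>\<alpha> - 1\<close>; the perpendicular bisector of
  these points is the line \<open>Re w = \<alpha>\<close>. If \<open>F = 0\<close>, both sides would
  be \<open>cmod N\<close>.\<close>

lemma Re_divide_gt_of_cmod_less:
  assumes "cmod (N - (1 + of_real \<alpha>) * F) < cmod (N + (1 - of_real \<alpha>) * F)"
  shows "F \<noteq> 0" "Re (N / F) > \<alpha>"
proof -
  show F: "F \<noteq> 0"
    using assms by auto
  define w where "w = N / F"
  have N: "N = w * F"
    using F by (simp add: w_def)
  have "cmod ((w - (1 + of_real \<alpha>)) * F) < cmod ((w + (1 - of_real \<alpha>)) * F)"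
    using assms unfolding N by (simp add: algebra_simps)
  then have "cmod (w - (1 + of_real \<alpha>)) < cmod (w + (1 - of_real \<alpha>))"
    using F by (simp add: norm_mult)
  then have "(Re w - (1 + \<alpha>))\<^sup>2 + (Im w)\<^sup>2 < (Re w + (1 - \<alpha>))\<^sup>2 + (Im w)\<^sup>2"
    by (simp add: cmod_def)
  then have "Re w > \<alpha>"
    by (simp add: power2_eq_square algebra_simps)
  then show "Re (N / F) > \<alpha>"
    by (simp add: w_def)
qed

text \<open>The strict hypothesis \<open>b1\<close> excludes the boundary case
  \<open>F z = z + cnj (b 1 * z)\<close> with
  \<open>(1 + \<alpha>) * cmod (b 1) = 1 - \<alpha>\<close>, which satisfies \<open>bound\<close>
  but violates the strict inequality in \<open>HS_star\<close>.\<close>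

lemma harmonic_starlike_of_coeff_bound:
  fixes a b :: "nat \<Rightarrow> complex"
  assumes \<alpha>: "0 \<le> \<alpha>" "\<alpha> < 1"
    and init: "a 0 = 0" "a 1 = 1" "b 0 = 0"
    and H: "\<And>z. z \<in> ball 0 1 \<Longrightarrow> (\<lambda>n. a n * z ^ n) sums H z"
    and G: "\<And>z. z \<in> ball 0 1 \<Longrightarrow> (\<lambda>n. b n * z ^ n) sums G z"
    and F: "\<And>z. z \<in> ball 0 1 \<Longrightarrow> F z = H z + cnj (G z)"
    and sa: "summable (\<lambda>n. real n * cmod (a n))" "summable (\<lambda>n. cmod (a n))"
    and sb: "summable (\<lambda>n. real n * cmod (b n))" "summable (\<lambda>n. cmod (b n))"
    and b1: "(1 + \<alpha>) * cmod (b 1) < 1 - \<alpha>"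
    and bound: "(\<Sum>n. (real (n + 2) - \<alpha>) * cmod (a (n + 2)))
      + (\<Sum>n. (real (n + 1) + \<alpha>) * cmod (b (n + 1))) \<le> 1 - \<alpha>"
  shows "F \<in> HS_star \<alpha>"
proof -
  have "cmod (b 1) < 1"
  proof -
    have "cmod (b 1) \<le> (1 + \<alpha>) * cmod (b 1)"
      using \<alpha> by (simp add: algebra_simps)
    then show ?thesis
      using b1 \<alpha> by linarith
  qed
  have rep: "harmonic_rep F H G a b"
    unfolding harmonic_rep_def
  proof (intro conjI ballI)
    show "H holomorphic_on ball 0 1"
      by (rule power_series_holomorphic[where a = a]) (use H in auto)
    show "G holomorphic_on ball 0 1"
      by (rule power_series_holomorphic[where a = b]) (use G in auto)
    fix z :: complex assume z: "z \<in> ball 0 1"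
    show "F z = H z + cnj (G z)"
      by (rule F[OF z])
    show "(\<lambda>n. a (n + 2) * z ^ (n + 2)) sums (H z - z)"
      using sums_split_initial_segment[OF H[OF z], of 2] init by (simp add: numeral_2_eq_2)
    show "(\<lambda>n. b (n + 1) * z ^ (n + 1)) sums G z"
      using sums_split_initial_segment[OF G[OF z], of 1] init by simp
  qed fact
  have "\<exists>d. has_arg_derivative (\<lambda>t. F (rcis r t)) d \<theta> \<and> d > \<alpha>" if r: "0 < r" "r < 1" for r \<theta>
  proof -
    define z where "z = rcis r \<theta>"
    have zr: "cmod z = r" and z: "z \<in> ball 0 1"
      using r by (auto simp: z_def)
    obtain H' where H': "(H has_field_derivative H') (at z)"
      and sH': "(\<lambda>n. of_nat n * a n * z ^ n) sums (z * H')"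
      using power_series_derivative[OF H z] by auto
    obtain G' where G': "(G has_field_derivative G') (at z)"
      and sG': "(\<lambda>n. of_nat n * b n * z ^ n) sums (z * G')"
      using power_series_derivative[OF G z] by auto
    \<comment> \<open>The minus sign arises because \<open>cnj\<close> turns \<open>\<i>\<close>
      into \<open>- \<i>\<close>: the derivative of \<open>F\<close> along the circle is
      \<open>\<i> * N\<close>.\<close>
    define N where "N = z * H' - cnj (z * G')"

    define A where "A = (\<Sum>n. (real (n + 2) - \<alpha>) * cmod (a (n + 2)))"
    define B where "B = (\<Sum>n. (real (n + 2) + \<alpha>) * cmod (b (n + 2)))"
    \<comment> \<open>The shift \<open>k\<close> is the multiple of \<open>H z\<close> or
      \<open>G z\<close> added to \<open>z * H'\<close> or \<open>z * G'\<close>. It will be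
      \<open>1 - \<alpha>\<close> and \<open>- 1 - \<alpha>\<close> for \<open>H\<close>, and,
      because of the sign in \<open>N\<close>, \<open>\<alpha> - 1\<close> and
      \<open>1 + \<alpha>\<close> for \<open>G\<close>.\<close>
    define TA where "TA = (\<lambda>k. \<Sum>n. (real (n + 2) + k) * cmod (a (n + 2)))"
    define TB where "TB = (\<lambda>k. \<Sum>n. (real (n + 2) + k) * cmod (b (n + 2)))"
    have smk: "summable (\<lambda>n. (real n + k) * cmod (c n))"
      if "summable (\<lambda>n. real n * cmod (c n))" "summable (\<lambda>n. cmod (c n))" for k and c :: "nat \<Rightarrow> complex"
      using summable_add[OF that(1) summable_mult[OF that(2), of k]] by (simp add: algebra_simps)
    \<comment> \<open>With \<open>k \<ge> -2\<close> the weights \<open>n + k\<close> are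
      nonnegative for \<open>n \<ge> 2\<close>, so the tail needs no absolute values. The smallest
      shift used is \<open>- 1 - \<alpha>\<close>, above \<open>-2\<close> since
      \<open>\<alpha> < 1\<close>.\<close>
    have tail: "cmod (z * D + of_real k * S - of_real k * c 0 - (1 + of_real k) * c 1 * z)
        \<le> r\<^sup>2 * (\<Sum>n. (real (n + 2) + k) * cmod (c (n + 2)))"
      if c: "summable (\<lambda>n. real n * cmod (c n))" "summable (\<lambda>n. cmod (c n))"
        and S: "(\<lambda>n. c n * z ^ n) sums S" "(\<lambda>n. of_nat n * c n * z ^ n) sums (z * D)"
        and k: "k \<ge> -2" for k D S and c :: "nat \<Rightarrow> complex"
    proof -
      define e where "e = (\<lambda>n. of_real (real n + k) * c n)"
      have "(\<lambda>n. e n * z ^ n) sums (z * D + of_real k * S)"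
        using sums_add[OF S(2) sums_mult[OF S(1), of "of_real k"]] by (simp add: e_def algebra_simps)
      moreover have "summable (\<lambda>n. cmod (e n))"
      proof -
        have "(\<lambda>n. cmod (e n)) = (\<lambda>n. \<bar>real n + k\<bar> * cmod (c n))"
          unfolding e_def by (simp only: norm_mult norm_of_real)
        moreover have "summable (\<lambda>n. (real n + \<bar>k\<bar>) * cmod (c n))"
          using smk[OF c] .
        then have "summable (\<lambda>n. \<bar>real n + k\<bar> * cmod (c n))"
          by (rule summable_comparison_test')
            (auto simp: abs_mult intro!: mult_right_mono)
        ultimately show ?thesis
          by simp
      qed
      ultimately have "cmod (z * D + of_real k * S - e 0 - e 1 * z) \<le> (cmod z)\<^sup>2 * (\<Sum>n. cmod (e (n + 2)))"
        by (rule power_series_tail_bound) (use zr r in simp)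
      moreover have "cmod (e (n + 2)) = (real (n + 2) + k) * cmod (c (n + 2))" for n
        unfolding e_def norm_mult norm_of_real using k by simp
      moreover have "e 0 = of_real k * c 0" "e 1 = (1 + of_real k) * c 1"
        by (simp_all add: e_def)
      ultimately show ?thesis
        by (simp only: zr)
    qed
    have tailH: "cmod (z * H' + of_real k * H z - (1 + of_real k) * z) \<le> r\<^sup>2 * TA k" if "k \<ge> -2" for k
      using tail[OF sa H[OF z] sH' that] init unfolding TA_def by simp
    have tailG: "cmod (z * G' + of_real k * G z - (1 + of_real k) * b 1 * z) \<le> r\<^sup>2 * TB k" if "k \<ge> -2" for k
      using tail[OF sb G[OF z] sG' that] init unfolding TB_def by simp
    have sms: "summable (\<lambda>n. (real (n + 2) + k) * cmod (a (n + 2)))"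
      "summable (\<lambda>n. (real (n + 2) + k) * cmod (b (n + 2)))" for k
      using smk[OF sa, of k, THEN summable_ignore_initial_segment, of 2]
        smk[OF sb, of k, THEN summable_ignore_initial_segment, of 2] by auto
    \<comment> \<open>The two shifts average to \<open>- \<alpha>\<close>, the shift in the
      coefficient condition; in \<open>TB\<close> below they average to
      \<open>\<alpha>\<close>.\<close>
    have TA: "TA (1 - \<alpha>) + TA (- 1 - \<alpha>) = 2 * A"
    proof -
      have "2 * A = (\<Sum>n. 2 * ((real (n + 2) - \<alpha>) * cmod (a (n + 2))))"
        unfolding A_def using sms(1)[of "-\<alpha>"] by (intro suminf_mult[symmetric]) simp
      also have "\<dots> = TA (1 - \<alpha>) + TA (- 1 - \<alpha>)"
        unfolding TA_def suminf_add[OF sms(1) sms(1)] by (simp add: algebra_simps)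
      finally show ?thesis ..
    qed
    have TB: "TB (\<alpha> - 1) + TB (1 + \<alpha>) = 2 * B"
    proof -
      have "2 * B = (\<Sum>n. 2 * ((real (n + 2) + \<alpha>) * cmod (b (n + 2))))"
        unfolding B_def using sms(2)[of "\<alpha>"] by (intro suminf_mult[symmetric]) simp
      also have "\<dots> = TB (\<alpha> - 1) + TB (1 + \<alpha>)"
        unfolding TB_def suminf_add[OF sms(2) sms(2)] by (simp add: algebra_simps)
      finally show ?thesis ..
    qed
    have bnd: "A + (1 + \<alpha>) * cmod (b 1) + B \<le> 1 - \<alpha>"
    proof -
      have "summable (\<lambda>n. (real (n + 1) + \<alpha>) * cmod (b (n + 1)))"
        using smk[OF sb, of \<alpha>, THEN summable_ignore_initial_segment, of 1] by simp
      from suminf_split_head[OF this]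
      have "(\<Sum>n. (real (n + 1) + \<alpha>) * cmod (b (n + 1))) = B + (1 + \<alpha>) * cmod (b 1)"
        unfolding B_def by (simp add: algebra_simps numeral_2_eq_2)
      then show ?thesis
        using bound unfolding A_def by linarith
    qed

    define \<beta> where "\<beta> = cmod (b 1)"
    define P where "P = N + (1 - of_real \<alpha>) * F z"
    define Q where "Q = N - (1 + of_real \<alpha>) * F z"
    define p1 where "p1 = z * H' + of_real (1 - \<alpha>) * H z - (1 + of_real (1 - \<alpha>)) * z"
    define p2 where "p2 = z * G' + of_real (\<alpha> - 1) * G z - (1 + of_real (\<alpha> - 1)) * b 1 * z"
    define q1 where "q1 = z * H' + of_real (- 1 - \<alpha>) * H z - (1 + of_real (- 1 - \<alpha>)) * z"
    define q2 where "q2 = z * G' + of_real (1 + \<alpha>) * G z - (1 + of_real (1 + \<alpha>)) * b 1 * z"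
    \<comment> \<open>\<open>P\<close> is to be bounded from below, so its dominant first-order term
      is isolated and the triangle inequality applied to it. \<open>Q\<close> is bounded from above
      and is expanded directly.\<close>
    have Peq: "of_real (2 - \<alpha>) * z = P - p1 + cnj p2 + of_real \<alpha> * cnj (b 1 * z)"
      unfolding P_def p1_def p2_def N_def F[OF z] by (simp add: algebra_simps)
    have Qeq: "Q = q1 - cnj q2 - of_real \<alpha> * z - of_real (2 + \<alpha>) * cnj (b 1 * z)"
      unfolding Q_def q1_def q2_def N_def F[OF z] by (simp add: algebra_simps)
    have nb: "cmod (b 1 * z) = \<beta> * r"
      by (simp add: norm_mult zr \<beta>_def)
    have p1: "cmod p1 \<le> r\<^sup>2 * TA (1 - \<alpha>)" and q1: "cmod q1 \<le> r\<^sup>2 * TA (- 1 - \<alpha>)"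
      and p2: "cmod p2 \<le> r\<^sup>2 * TB (\<alpha> - 1)" and q2: "cmod q2 \<le> r\<^sup>2 * TB (1 + \<alpha>)"
      unfolding p1_def p2_def q1_def q2_def using \<alpha> by (intro tailH tailG; simp)+
    have "(2 - \<alpha>) * r = cmod (of_real (2 - \<alpha>) * z)"
      unfolding norm_mult norm_of_real zr using \<alpha> by simp
    also have "\<dots> \<le> cmod P + cmod p1 + cmod p2 + \<alpha> * (\<beta> * r)"
    proof -
      have "cmod (of_real \<alpha> * cnj (b 1 * z)) = \<alpha> * (\<beta> * r)"
        unfolding norm_mult[of "of_real \<alpha>"] norm_of_real complex_mod_cnj nb using \<alpha> by simp
      then show ?thesis
        unfolding Peq
        by (smt (verit) complex_mod_cnj norm_triangle_ineq norm_triangle_ineq4)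
    qed
    finally have "(2 - \<alpha>) * r - \<alpha> * (\<beta> * r) - r\<^sup>2 * (TA (1 - \<alpha>) + TB (\<alpha> - 1)) \<le> cmod P"
      using p1 p2 by (simp add: algebra_simps)
    moreover have "cmod Q \<le> \<alpha> * r + (2 + \<alpha>) * (\<beta> * r) + r\<^sup>2 * (TA (- 1 - \<alpha>) + TB (1 + \<alpha>))"
    proof -
      have "cmod (of_real (2 + \<alpha>) * cnj (b 1 * z)) = (2 + \<alpha>) * (\<beta> * r)"
        unfolding norm_mult[of "of_real (2 + \<alpha>)"] norm_of_real complex_mod_cnj nb using \<alpha> by simp
      moreover have "cmod (of_real \<alpha> * z) = \<alpha> * r"
        unfolding norm_mult norm_of_real zr using \<alpha> by simp
      ultimately have "cmod Q \<le> cmod q1 + cmod q2 + \<alpha> * r + (2 + \<alpha>) * (\<beta> * r)"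
        unfolding Qeq by (smt (verit) complex_mod_cnj norm_triangle_ineq4)
      then show ?thesis
        using q1 q2 by (simp add: algebra_simps)
    qed
    moreover have "r\<^sup>2 * (TA (1 - \<alpha>) + TB (\<alpha> - 1)) + r\<^sup>2 * (TA (- 1 - \<alpha>) + TB (1 + \<alpha>)) = 2 * r\<^sup>2 * (A + B)"
      using TA TB by algebra
    \<comment> \<open>The right side equals
      \<open>2 * r * (1 - \<alpha> - (1 + \<alpha>) * \<beta>)\<close>. Its last factor is positive
      by \<open>b1\<close> and bounds \<open>A + B\<close> by \<open>bnd\<close>, so the extra
      factor \<open>r < 1\<close> on the left makes the inequality strict.\<close>
    moreover have "2 * r\<^sup>2 * (A + B) < (2 - \<alpha>) * r - \<alpha> * (\<beta> * r) - (\<alpha> * r + (2 + \<alpha>) * (\<beta> * r))"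
    proof -
      have "r * (A + B) \<le> r * (1 - \<alpha> - (1 + \<alpha>) * \<beta>)"
        using bnd r by (intro mult_left_mono) (auto simp: \<beta>_def)
      also have "\<dots> < 1 * (1 - \<alpha> - (1 + \<alpha>) * \<beta>)"
        using b1 r by (intro mult_strict_right_mono) (auto simp: \<beta>_def)
      finally have "2 * r * (r * (A + B)) < 2 * r * (1 - \<alpha> - (1 + \<alpha>) * \<beta>)"
        using r by simp
      then show ?thesis
        by (simp add: algebra_simps power2_eq_square)
    qed
    ultimately have "cmod Q < cmod P"
      by linarith
    then have Fz: "F z \<noteq> 0" and gt: "Re (N / F z) > \<alpha>"
      using Re_divide_gt_of_cmod_less unfolding P_def Q_def by blast+

    have rc: "((\<lambda>t. rcis r t) has_vector_derivative \<i> * z) (at \<theta>)"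
      unfolding rcis_def z_def has_vector_derivative_def
      by (auto intro!: derivative_eq_intros simp: algebra_simps scaleR_conv_of_real)
    have dH: "((\<lambda>t. H (rcis r t)) has_vector_derivative \<i> * z * H') (at \<theta>)"
      using field_vector_diff_chain_at[OF rc H'[unfolded z_def]] by (simp add: o_def)
    have dG: "((\<lambda>t. G (rcis r t)) has_vector_derivative \<i> * z * G') (at \<theta>)"
      using field_vector_diff_chain_at[OF rc G'[unfolded z_def]] by (simp add: o_def)
    have "((\<lambda>t. H (rcis r t) + cnj (G (rcis r t))) has_vector_derivative \<i> * z * H' + cnj (\<i> * z * G')) (at \<theta>)"
      by (intro has_vector_derivative_add dH has_vector_derivative_cnj dG)
    moreover have "\<i> * z * H' + cnj (\<i> * z * G') = \<i> * N"
      by (simp add: N_def algebra_simps)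
    moreover have "(\<lambda>t. F (rcis r t)) = (\<lambda>t. H (rcis r t) + cnj (G (rcis r t)))"
      using F r by auto
    ultimately have "((\<lambda>t. F (rcis r t)) has_vector_derivative \<i> * N) (at \<theta>)"
      by simp
    from has_arg_derivative_Im[OF this] Fz
    have "has_arg_derivative (\<lambda>t. F (rcis r t)) (Im (\<i> * N / F z)) \<theta>"
      by (simp add: z_def)
    moreover have "Im (\<i> * N / F z) = Re (N / F z)"
      by (metis Im_i_times times_divide_eq_right)
    ultimately show ?thesis
      using gt by metis
  qed
  then show ?thesis
    using rep unfolding HS_star_def H_hat_def by blast
qed

section \<open>Wright coefficients and the Wright series\<close>

lemma wright_coeff_pos:
  assumes "a > 0" "c > 0" "b \<ge> 0" "d \<ge> 0" "n \<ge> 1"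
  shows "wright_coeff a b c d n > 0"
proof -
  have "a + (real n - 1) * b > 0" "c + (real n - 1) * d > 0"
    using assms by (auto intro!: add_pos_nonneg)
  then show ?thesis
    using assms by (simp add: wright_coeff_def)
qed

lemma wright_coeff_1:
  assumes "a > 0" "c > 0"
  shows "wright_coeff a b c d 1 = 1"
  using assms[THEN Gamma_real_pos] by (simp add: wright_coeff_def)

text \<open>The coefficient at \<open>0\<close> is overridden because \<^const>\<open>wright_coeff\<close> need not vanish there.\<close>

lemma wright_sums:
  fixes z :: "'a::{real_normed_field,banach}"
  assumes pos: "a > 0" "c > 0" "b \<ge> 0" "d \<ge> 0" and fin: "wright_finite_at_1 a b c d" and z: "norm z \<le> 1"
  shows "(\<lambda>n. of_real (if n = 0 then 0 else wright_coeff a b c d n) * z ^ n) sums wright a b c d z"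
proof -
  have "summable (\<lambda>n. of_real (wright_coeff a b c d (n + 2)) * z ^ (n + 2))"
  proof (rule summable_comparison_test')
    show "summable (\<lambda>n. wright_coeff a b c d (n + 2))"
      using fin by (simp add: wright_finite_at_1_def)
    fix n :: nat
    have "wright_coeff a b c d (n + 2) > 0"
      by (rule wright_coeff_pos[OF pos]) simp
    moreover have "norm z ^ (n + 2) \<le> 1"
      using z by (intro power_le_one) auto
    ultimately show "norm (of_real (wright_coeff a b c d (n + 2)) * z ^ (n + 2)) \<le> wright_coeff a b c d (n + 2)"
      by (simp add: norm_mult norm_power mult_left_le)
  qed
  then have "(\<lambda>n. of_real (wright_coeff a b c d (n + 2)) * z ^ (n + 2)) sums (wright a b c d z - z)"
    by (simp add: wright_def summable_sums)
  then have "(\<lambda>n. of_real (if n + 2 = 0 then 0 else wright_coeff a b c d (n + 2)) * z ^ (n + 2))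
      sums (wright a b c d z - (\<Sum>n<2. of_real (if n = 0 then 0 else wright_coeff a b c d n) * z ^ n))"
    using wright_coeff_1[OF pos(1,2), of b d] by (simp add: numeral_2_eq_2)
  then show ?thesis
    by (rule sums_iff_shift'[THEN iffD1])
qed

section \<open>Harmonic parts and Hadamard products as power series\<close>

lemma harmonic_rep_analytic_part:
  assumes "harmonic_rep f h g A B" "z \<in> ball 0 1"
  shows "analytic_part f z = h z"
proof -
  have "\<exists>g A B. harmonic_rep f (analytic_part f) g A B"
    unfolding analytic_part_def
    by (rule someI_ex[of "\<lambda>h. \<exists>g A B. harmonic_rep f h g A B"]) (use assms in blast)
  then show ?thesis
    using harmonic_rep_unique(1) assms by metis
qed

lemma harmonic_rep_coanalytic_part:
  assumes "harmonic_rep f h g A B" "z \<in> ball 0 1"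
  shows "coanalytic_part f z = g z"
proof -
  have "\<exists>h A B. harmonic_rep f h (coanalytic_part f) A B"
    unfolding coanalytic_part_def
    by (rule someI_ex[of "\<lambda>g. \<exists>h A B. harmonic_rep f h g A B"]) (use assms in blast)
  then show ?thesis
    using harmonic_rep_unique(2) assms by metis
qed

text \<open>The Taylor coefficients of the factors are \<open>c n\<close> and \<open>e n\<close>.
  Domination by \<open>cmod (c n * e n)\<close> on the disk ensures that the \<open>suminf\<close>
  in \<open>hadamard_product\<close> is a genuine sum.\<close>

lemma hadamard_product_sums:
  fixes p q :: "complex \<Rightarrow> complex"
  assumes p: "\<And>z. z \<in> ball 0 1 \<Longrightarrow> (\<lambda>n. c n * z ^ n) sums p z"
    and q: "\<And>z. z \<in> ball 0 1 \<Longrightarrow> (\<lambda>n. e n * z ^ n) sums q z"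
    and sm: "summable (\<lambda>n. cmod (c n * e n))" and z: "z \<in> ball 0 1"
  shows "(\<lambda>n. c n * e n * z ^ n) sums hadamard_product p q z"
proof -
  have "summable (\<lambda>n. c n * e n * z ^ n)"
  proof (rule summable_comparison_test'[OF sm])
    fix n :: nat
    have "cmod z ^ n \<le> 1"
      using z by (intro power_le_one) auto
    then show "cmod (c n * e n * z ^ n) \<le> cmod (c n * e n)"
      by (simp add: norm_mult[of "c n * e n"] norm_power mult_left_le)
  qed
  moreover have "(deriv ^^ n) p 0 / fact n = c n" "(deriv ^^ n) q 0 / fact n = e n" for n
    using power_series_taylor_coeff p q by blast+
  ultimately show ?thesis
    by (simp only: hadamard_product_def summable_sums)
qed

section \<open>Majorization by Wright coefficients and conclusion\<close>

theorem theorem1: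
  fixes \<alpha> \<alpha>\<^sub>1 \<beta>\<^sub>1 \<gamma>\<^sub>1 \<delta>\<^sub>1 \<alpha>\<^sub>2 \<beta>\<^sub>2 \<gamma>\<^sub>2 \<delta>\<^sub>2 :: real
    and \<sigma> :: complex
    and f h g :: "complex \<Rightarrow> complex"
    and A B :: "nat \<Rightarrow> complex"
  assumes "0 \<le> \<alpha>" "\<alpha> < 1"
    and "\<alpha>\<^sub>1 > 0" "\<alpha>\<^sub>2 > 0" "\<gamma>\<^sub>1 > 0" "\<gamma>\<^sub>2 > 0"
    and "\<beta>\<^sub>1 \<ge> 0" "\<beta>\<^sub>2 \<ge> 0" "\<delta>\<^sub>1 \<ge> 0" "\<delta>\<^sub>2 \<ge> 0"
    and "cmod \<sigma> < 1"
    and "harmonic_rep f h g A B"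
    and "\<And>n. n \<ge> 2 \<Longrightarrow> cmod (A n) \<le> 1"
    and "\<And>n. n \<ge> 1 \<Longrightarrow> cmod (B n) \<le> 1"
    and "wright_finite_at_1 \<alpha>\<^sub>1 \<beta>\<^sub>1 \<gamma>\<^sub>1 \<delta>\<^sub>1"
    and "wright_finite_at_1 \<alpha>\<^sub>2 \<beta>\<^sub>2 \<gamma>\<^sub>2 \<delta>\<^sub>2"
    and "(wright_deriv \<alpha>\<^sub>1 \<beta>\<^sub>1 \<gamma>\<^sub>1 \<delta>\<^sub>1 1 - 1) - \<alpha> * (wright \<alpha>\<^sub>1 \<beta>\<^sub>1 \<gamma>\<^sub>1 \<delta>\<^sub>1 1 - 1)
          + cmod \<sigma> * (wright_deriv \<alpha>\<^sub>2 \<beta>\<^sub>2 \<gamma>\<^sub>2 \<delta>\<^sub>2 1 + \<alpha> * wright \<alpha>\<^sub>2 \<beta>\<^sub>2 \<gamma>\<^sub>2 \<delta>\<^sub>2 1) \<le> 1 - \<alpha>"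
  shows "wright_op \<alpha>\<^sub>1 \<beta>\<^sub>1 \<gamma>\<^sub>1 \<delta>\<^sub>1 \<alpha>\<^sub>2 \<beta>\<^sub>2 \<gamma>\<^sub>2 \<delta>\<^sub>2 \<sigma> f \<in> HS_star \<alpha>"
proof -
  note \<alpha> = assms(1,2)
  note pos1 = assms(3,5,7,9) and pos2 = assms(4,6,8,10)
  note rep = assms(12) and A = assms(13) and B = assms(14) and fin1 = assms(15) and fin2 = assms(16)
  define w1 where "w1 = (\<lambda>n. if n = 0 then 0 else wright_coeff \<alpha>\<^sub>1 \<beta>\<^sub>1 \<gamma>\<^sub>1 \<delta>\<^sub>1 n)"
  define w2 where "w2 = (\<lambda>n. if n = 0 then 0 else wright_coeff \<alpha>\<^sub>2 \<beta>\<^sub>2 \<gamma>\<^sub>2 \<delta>\<^sub>2 n)"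
  have w1: "w1 0 = 0" "w1 1 = 1" "\<And>n. n \<ge> 1 \<Longrightarrow> w1 n > 0" "\<And>n. w1 n \<ge> 0"
    using wright_coeff_1[OF pos1(1,2)] wright_coeff_pos[OF pos1]
    by (auto simp: w1_def less_imp_le)
  have w2: "w2 0 = 0" "w2 1 = 1" "\<And>n. n \<ge> 1 \<Longrightarrow> w2 n > 0" "\<And>n. w2 n \<ge> 0"
    using wright_coeff_1[OF pos2(1,2)] wright_coeff_pos[OF pos2]
    by (auto simp: w2_def less_imp_le)
  have sm1: "summable w1" "summable (\<lambda>n. real n * w1 n)"
    using fin1 summable_iff_shift[of w1 2] summable_iff_shift[of "\<lambda>n. real n * w1 n" 2]
    by (simp_all add: wright_finite_at_1_def w1_def)
  have sm2: "summable w2" "summable (\<lambda>n. real n * w2 n)"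
    using fin2 summable_iff_shift[of w2 2] summable_iff_shift[of "\<lambda>n. real n * w2 n" 2]
    by (simp_all add: wright_finite_at_1_def w2_def)

  \<comment> \<open>\<open>harmonic_rep\<close> leaves \<open>A 0\<close>, \<open>A 1\<close> and
    \<open>B 0\<close> unconstrained, so these entries are replaced by the true Taylor
    coefficients.\<close>
  define A' where "A' = (\<lambda>n. if n = 0 then 0 else if n = 1 then 1 else A n)"
  define B' where "B' = (\<lambda>n. if n = 0 then 0 else B n)"
  have A': "cmod (A' n) \<le> 1" for n
    using A[of n] by (auto simp: A'_def)
  have B': "cmod (B' n) \<le> 1" for n
    using B[of n] by (auto simp: B'_def)
  have sA: "(\<lambda>n. A' n * z ^ n) sums analytic_part f z" if z: "z \<in> ball 0 1" for z
  proof -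
    have "(\<lambda>n. A (n + 2) * z ^ (n + 2)) sums (h z - z)"
      using rep z unfolding harmonic_rep_def by blast
    then have "(\<lambda>n. A' (n + 2) * z ^ (n + 2)) sums (h z - (\<Sum>n<2. A' n * z ^ n))"
      by (simp add: A'_def numeral_2_eq_2)
    then show ?thesis
      unfolding harmonic_rep_analytic_part[OF rep z] by (rule sums_iff_shift'[THEN iffD1])
  qed
  have sB: "(\<lambda>n. B' n * z ^ n) sums coanalytic_part f z" if z: "z \<in> ball 0 1" for z
  proof -
    have "(\<lambda>n. B (n + 1) * z ^ (n + 1)) sums g z"
      using rep z unfolding harmonic_rep_def by blast
    then have "(\<lambda>n. B' (n + 1) * z ^ (n + 1)) sums (g z - (\<Sum>n<1. B' n * z ^ n))"
      by (simp add: B'_def)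
    then show ?thesis
      unfolding harmonic_rep_coanalytic_part[OF rep z] by (rule sums_iff_shift'[THEN iffD1])
  qed

  \<comment> \<open>These are the coefficients of the two parts of the image of \<open>f\<close>,
    with \<open>\<sigma>\<close> absorbed into the co-analytic one.\<close>
  define a where "a = (\<lambda>n. A' n * of_real (w1 n))"
  define b where "b = (\<lambda>n. \<sigma> * (B' n * of_real (w2 n)))"
  have a_le: "cmod (a n) \<le> w1 n" for n
    using mult_right_mono[OF A' w1(4), of n n] w1(4)[of n] by (simp add: a_def norm_mult)
  have Bw_le: "cmod (B' n * of_real (w2 n)) \<le> w2 n" for n
    using mult_right_mono[OF B' w2(4), of n n] w2(4)[of n] by (simp add: norm_mult)
  have b_le: "cmod (b n) \<le> cmod \<sigma> * w2 n" for n
    using mult_left_mono[OF Bw_le, of "cmod \<sigma>" n] by (simp add: b_def norm_mult)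
  have sa: "summable (\<lambda>n. cmod (a n))" "summable (\<lambda>n. real n * cmod (a n))"
    by (rule summable_comparison_test'[OF sm1(1)] summable_comparison_test'[OF sm1(2)],
        use a_le in \<open>simp add: mult_left_mono\<close>)+
  have sBw: "summable (\<lambda>n. cmod (B' n * of_real (w2 n)))"
    by (rule summable_comparison_test'[OF sm2(1)]) (use Bw_le in simp)
  have sb: "summable (\<lambda>n. cmod (b n))" "summable (\<lambda>n. real n * cmod (b n))"
  proof -
    show "summable (\<lambda>n. cmod (b n))"
      by (rule summable_comparison_test'[OF summable_mult[OF sm2(1), of "cmod \<sigma>"]]) (use b_le in simp)
    show "summable (\<lambda>n. real n * cmod (b n))"
      by (rule summable_comparison_test'[OF summable_mult[OF sm2(2), of "cmod \<sigma>"]])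
        (use mult_left_mono[OF b_le] in \<open>simp add: algebra_simps\<close>)
  qed

  define S1 where "S1 = (\<Sum>n. (real (n + 2) - \<alpha>) * w1 (n + 2))"
  define S2 where "S2 = (\<Sum>n. (real (n + 1) + \<alpha>) * w2 (n + 1))"
  have s1: "(\<lambda>n. (real (n + 2) - \<alpha>) * w1 (n + 2)) sums
      ((wright_deriv \<alpha>\<^sub>1 \<beta>\<^sub>1 \<gamma>\<^sub>1 \<delta>\<^sub>1 1 - 1) - \<alpha> * (wright \<alpha>\<^sub>1 \<beta>\<^sub>1 \<gamma>\<^sub>1 \<delta>\<^sub>1 1 - 1))"
  proof -
    have "(\<lambda>n. real (n + 2) * w1 (n + 2)) sums (wright_deriv \<alpha>\<^sub>1 \<beta>\<^sub>1 \<gamma>\<^sub>1 \<delta>\<^sub>1 1 - 1)"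
      using fin1 by (simp add: wright_deriv_def wright_finite_at_1_def w1_def summable_sums)
    moreover have "(\<lambda>n. w1 (n + 2)) sums (wright \<alpha>\<^sub>1 \<beta>\<^sub>1 \<gamma>\<^sub>1 \<delta>\<^sub>1 1 - 1)"
      using fin1 by (simp add: wright_def wright_finite_at_1_def w1_def summable_sums)
    ultimately show ?thesis
      using sums_diff sums_mult by (fastforce simp: algebra_simps)
  qed
  have s2: "(\<lambda>n. (real (n + 1) + \<alpha>) * w2 (n + 1)) sums
      (wright_deriv \<alpha>\<^sub>2 \<beta>\<^sub>2 \<gamma>\<^sub>2 \<delta>\<^sub>2 1 + \<alpha> * wright \<alpha>\<^sub>2 \<beta>\<^sub>2 \<gamma>\<^sub>2 \<delta>\<^sub>2 1)"
  proof -
    have d: "(\<lambda>n. real (n + 2) * w2 (n + 2)) sums (wright_deriv \<alpha>\<^sub>2 \<beta>\<^sub>2 \<gamma>\<^sub>2 \<delta>\<^sub>2 1 - 1)"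
      using fin2 by (simp add: wright_deriv_def wright_finite_at_1_def w2_def summable_sums)
    have w: "(\<lambda>n. w2 (n + 2)) sums (wright \<alpha>\<^sub>2 \<beta>\<^sub>2 \<gamma>\<^sub>2 \<delta>\<^sub>2 1 - 1)"
      using fin2 by (simp add: wright_def wright_finite_at_1_def w2_def summable_sums)
    \<comment> \<open>The terms from the quadratic one on are summed first; the missing
      \<open>1 + \<alpha>\<close> is the contribution of the leading \<open>z\<close> of the second
      Wright function, which \<open>sums_Suc\<close> restores.\<close>
    have "(\<lambda>n. (real (Suc n + 1) + \<alpha>) * w2 (Suc n + 1)) sums
      (wright_deriv \<alpha>\<^sub>2 \<beta>\<^sub>2 \<gamma>\<^sub>2 \<delta>\<^sub>2 1 + \<alpha> * wright \<alpha>\<^sub>2 \<beta>\<^sub>2 \<gamma>\<^sub>2 \<delta>\<^sub>2 1 - (1 + \<alpha>))"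
      using sums_add[OF d sums_mult[OF w, of \<alpha>]] by (simp add: algebra_simps)
    from sums_Suc[OF this] show ?thesis
      using w2(2) by simp
  qed
  have S: "S1 + cmod \<sigma> * S2 \<le> 1 - \<alpha>"
    using assms(17) s1 s2 by (simp add: S1_def S2_def sums_iff)
  \<comment> \<open>Positivity of \<open>S1\<close> provides the strict condition on
    \<open>b 1\<close>: \<open>(1 + \<alpha>) * cmod \<sigma> \<le> cmod \<sigma> * S2 \<le> 1 -
    \<alpha> - S1 < 1 - \<alpha>\<close>.\<close>
  have "S1 > 0"
    unfolding S1_def using s1 w1(3) \<alpha> by (intro suminf_pos) (auto simp: sums_iff)
  have "1 + \<alpha> \<le> S2"
    unfolding S2_def using sum_le_suminf[of _ "{0}", OF sums_summable[OF s2]] w2 \<alpha>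
    by (simp del: of_nat_add)

  show ?thesis
  proof (rule harmonic_starlike_of_coeff_bound[OF \<alpha>, where a = a and b = b])
    show "a 0 = 0" "a 1 = 1" "b 0 = 0"
      using w1 w2 by (auto simp: a_def b_def A'_def)
    show "(\<lambda>n. a n * z ^ n) sums hadamard_product (analytic_part f) (wright \<alpha>\<^sub>1 \<beta>\<^sub>1 \<gamma>\<^sub>1 \<delta>\<^sub>1) z"
      if "z \<in> ball 0 1" for z
      unfolding a_def
    proof (rule hadamard_product_sums[OF sA _ _ that])
      show "(\<lambda>n. of_real (w1 n) * z ^ n) sums wright \<alpha>\<^sub>1 \<beta>\<^sub>1 \<gamma>\<^sub>1 \<delta>\<^sub>1 z" if "z \<in> ball 0 1" for z :: complex
        unfolding w1_def using that by (intro wright_sums pos1 fin1) auto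
    qed (use sa in \<open>auto simp: a_def\<close>)
    show "(\<lambda>n. b n * z ^ n) sums (\<sigma> * hadamard_product (coanalytic_part f) (wright \<alpha>\<^sub>2 \<beta>\<^sub>2 \<gamma>\<^sub>2 \<delta>\<^sub>2) z)"
      if "z \<in> ball 0 1" for z
    proof -
      have "(\<lambda>n. B' n * of_real (w2 n) * z ^ n) sums hadamard_product (coanalytic_part f) (wright \<alpha>\<^sub>2 \<beta>\<^sub>2 \<gamma>\<^sub>2 \<delta>\<^sub>2) z"
      proof (rule hadamard_product_sums[OF sB _ sBw that])
        show "(\<lambda>n. of_real (w2 n) * z ^ n) sums wright \<alpha>\<^sub>2 \<beta>\<^sub>2 \<gamma>\<^sub>2 \<delta>\<^sub>2 z" if "z \<in> ball 0 1" for z :: complex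
          unfolding w2_def using that by (intro wright_sums pos2 fin2) auto
      qed
      from sums_mult[OF this, of \<sigma>] show ?thesis
        by (simp add: b_def mult.assoc)
    qed
    show "(1 + \<alpha>) * cmod (b 1) < 1 - \<alpha>"
    proof -
      have "(1 + \<alpha>) * cmod (b 1) \<le> S2 * cmod \<sigma>"
        using b_le[of 1] w2(2) \<alpha> \<open>1 + \<alpha> \<le> S2\<close> by (intro mult_mono) auto
      then show ?thesis
        using S \<open>S1 > 0\<close> by (simp add: mult.commute)
    qed
    have "(\<Sum>n. (real (n + 2) - \<alpha>) * cmod (a (n + 2))) \<le> S1"
      unfolding S1_def
    proof (rule suminf_le[OF _ _ sums_summable[OF s1]])
      show le: "(real (n + 2) - \<alpha>) * cmod (a (n + 2)) \<le> (real (n + 2) - \<alpha>) * w1 (n + 2)" for n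
        using \<alpha> by (intro mult_left_mono a_le) simp
      show "summable (\<lambda>n. (real (n + 2) - \<alpha>) * cmod (a (n + 2)))"
        by (rule summable_comparison_test'[OF sums_summable[OF s1]]) (use le \<alpha> in \<open>simp add: abs_mult\<close>)
    qed
    moreover have "(\<Sum>n. (real (n + 1) + \<alpha>) * cmod (b (n + 1))) \<le> cmod \<sigma> * S2"
      unfolding S2_def suminf_mult[OF sums_summable[OF s2], symmetric]
    proof (rule suminf_le[OF _ _ summable_mult[OF sums_summable[OF s2]]])
      show le: "(real (n + 1) + \<alpha>) * cmod (b (n + 1)) \<le> cmod \<sigma> * ((real (n + 1) + \<alpha>) * w2 (n + 1))" for n
        using mult_left_mono[OF b_le[of "n + 1"], of "real (n + 1) + \<alpha>"] \<alpha> by (simp add: mult_ac)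
      show "summable (\<lambda>n. (real (n + 1) + \<alpha>) * cmod (b (n + 1)))"
        by (rule summable_comparison_test'[OF summable_mult[OF sums_summable[OF s2], of "cmod \<sigma>"]])
          (use le \<alpha> in \<open>simp add: abs_mult\<close>)
    qed
    ultimately show "(\<Sum>n. (real (n + 2) - \<alpha>) * cmod (a (n + 2)))
        + (\<Sum>n. (real (n + 1) + \<alpha>) * cmod (b (n + 1))) \<le> 1 - \<alpha>"
      using S by linarith
  qed (use sa sb in \<open>auto simp: wright_op_def\<close>)
qed

end
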